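(* (Strong normalisation.) In the dagger lambda calculus, every sequence of soup reduction steps starting from a typing judgement (judgements being considered up to $\alpha$-equivalence) is finite, and, when continued until no soup rule applies, ends with a typing judgement in normal form, i.e. one to which none of the soup rules (bifunctoriality, trace, cancellation, consumption) applies.
   Context: The dagger lambda calculus. Types are generated from atomic types by $A^*$ and $A\otimes B$, with $(A^* )^*\equiv A$ and $(A\otimes B)^* := B^*\otimes A^*$; one atomic type $I$, with $I\equiv I^*$, acts as tensor unit. Terms are generated from typed variables and typed constants by $t_*$ and $t\otimes u$; if $t:A$ and $u:B$ then $t_*:A^*$ and $t\otimes u:A\otimes B$; $(t_* )_*\equiv t$ and $(t\otimes u)_* := u_*\otimes t_*$. For each type $A$ there is a constant $D_A:I$, with $D_I=1$ and $1=1_*$. A soup connection $t:u$ (also $t:_A u$) is an ordered pair of terms of the same type $A$, with the identification $t:u\equiv u_*:t_*$ and negation $(t:u)_* := t_*:u_*\equiv u:t$. A soup is a set of connections $\{v_1:v_2,\dots,v_{m-1}:v_m\}$; $S_*$ negates each connection. A typing judgement (sequent) has the form $t_1:A_1,\dots,t_n:A_n\vdash_S t:B$ with $S$ a soup ($\vdash$ means empty soup). A variable is bound if it occurs twice in the judgement (anywhere, including the soup); a term is bound (captured) if it contains no constants and all its variables are bound. $\alpha$-renaming replaces all occurrences of a bound variable by a constant-free term of the same type made of variables not occurring in the judgement, or replaces both occurrences of a bound term occurring twice by a fresh variable of the same type; $\alpha$-equivalence is its reflexive symmetric transitive closure. For $\Delta=t_1:T_1,\dots,t_n:T_n$, $\bigotimes\Delta$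 is $((t_1\otimes t_2)\otimes\dots)\otimes t_n:((T_1\otimes T_2)\otimes\dots)\otimes T_n$. Judgements are derived by the following rules. Id: $x:A\vdash x:A$. Negation: from $a:A\vdash_S b:B$ infer $a_*:A^*\vdash_{S_*}b_*:B^*$. Cut: from $\Gamma\vdash_{S_1}a:A$ and $a':A,\Delta\vdash_{S_2}b:B$ infer $\Gamma,\Delta\vdash_{S_1\cup S_2\cup\{a:a'\}}b:B$. $\otimes R$: from $\Gamma\vdash_{S_1}a:A$ and $\Delta\vdash_{S_2}b:B$ infer $\Gamma,\bigotimes\Delta\vdash_{S_1\cup S_2}a\otimes b:A\otimes B$. Curry (both directions): $a:A,\Gamma\vdash_S b:B$ iff $\Gamma\vdash_S a_*\otimes b:A^*\otimes B$. $\otimes L$ (both directions): $\Gamma,a:A,b:B\vdash_S c:C$ iff $\Gamma,a\otimes b:A\otimes B\vdash_S c:C$. Exchange: adjacent left-hand terms may be swapped. Unit rules (both directions): $\Gamma\vdash_{S\cup\{i_*:1\}}b:B$ iff $i:I,\Gamma\vdash_S b:B$; and $\Gamma\vdash_{S\cup\{i_*:1\}}b:B$ iff $\Gamma,i:I\vdash_S b:B$. The premises of Cut and $\otimes R$ must share no variables ($\alpha$-rename first if needed), so every variable in a derivable judgement occurs exactly twice (linearity). Constants are introduced by $\vdash 1:I$ and, for a constant $f:A^*\otimes B$, by $a:A\vdash_{\{f:a_*\otimes b\}}b:B$. Soup reduction extends $\alpha$-equivalence by four rules. Bifunctoriality: $S\cup\{a\otimes b:c\otimes d\}\to S\cup\{a:c,b:d\}$.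 Trace: $S\cup\{x:_A x\}\to S\cup\{D_A:1\}$ ($x$ a variable). Cancellation: $S\cup\{1:1\}\to S$. Consumption: $\Gamma\vdash_{S\cup\{t:u\}}b:B\to(\Gamma\vdash_S b:B)[t/u]$ if $u$ contains no constants, or $\to(\Gamma\vdash_S b:B)[u/t]$ if $t$ contains no constants; here $[t/u]$ substitutes $t$ for $u$ throughout the whole judgement (including the soup), and the term substituted for must be one that was captured in the judgement. A soup reduction step means one application of one of these four rules. *)

theory Defs
  imports "HOL-Library.FSet"
begin

section \<open>Types and terms\<close>

text \<open>
  Types are taken modulo \<open>(A\<^sup>*)\<^sup>* = A\<close>, \<open>(A \<otimes> B)\<^sup>* = B\<^sup>* \<otimes> A\<^sup>*\<close> and \<open>I\<^sup>* = I\<close>, so stars are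
  pushed down to the atoms: \<open>Atom X False\<close> is the atomic type \<open>X\<close>, \<open>Atom X True\<close> is \<open>X\<^sup>*\<close>.
\<close>

datatype 'a ty =
    Unit
  | Atom 'a bool
  | TTensor "'a ty" "'a ty"  (infixl "\<otimes>\<^sub>T" 70)

primrec dual :: "'a ty \<Rightarrow> 'a ty" where
  "dual Unit = Unit"
| "dual (Atom X p) = Atom X (\<not> p)"
| "dual (A \<otimes>\<^sub>T B) = dual B \<otimes>\<^sub>T dual A"

text \<open>Variables and constants carry their types; there are infinitely many variables of each type.\<close>

type_synonym 'a var = "nat \<times> 'a ty"

abbreviation var_type :: "'a var \<Rightarrow> 'a ty" where
  "var_type x \<equiv> snd x"

datatype ('a, 'c) const =
    Sym 'c "'a ty"
  | Dim "'a ty"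

primrec const_type :: "('a, 'c) const \<Rightarrow> 'a ty" where
  "const_type (Sym c A) = A"
| "const_type (Dim A) = Unit"

text \<open>
  Terms are likewise taken modulo \<open>(t\<^sub>*)\<^sub>* = t\<close>, \<open>(t \<otimes> u)\<^sub>* = u\<^sub>* \<otimes> t\<^sub>*\<close> and \<open>1\<^sub>* = 1\<close>: stars occur only on
  variables and on constants other than \<open>1\<close>, where they are recorded by the flag.
\<close>

datatype ('a, 'c) trm =
    Var "'a var" bool
  | Con "('a, 'c) const" bool
  | One
  | Tensor "('a, 'c) trm" "('a, 'c) trm"  (infixl "\<otimes>" 70)

abbreviation V :: "'a var \<Rightarrow> ('a, 'c) trm" where
  "V x \<equiv> Var x False"

primrec neg :: "('a, 'c) trm \<Rightarrow> ('a, 'c) trm" where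
  "neg (Var x p) = Var x (\<not> p)"
| "neg (Con k p) = Con k (\<not> p)"
| "neg One = One"
| "neg (t \<otimes> u) = neg u \<otimes> neg t"

primrec type_of :: "('a, 'c) trm \<Rightarrow> 'a ty" where
  "type_of (Var x p) = (if p then dual (var_type x) else var_type x)"
| "type_of (Con k p) = (if p then dual (const_type k) else const_type k)"
| "type_of One = Unit"
| "type_of (t \<otimes> u) = type_of t \<otimes>\<^sub>T type_of u"

text \<open>
  The scalar \<open>D\<^sub>A\<close>.  Since \<open>D\<^sub>I = 1\<close>, the value \<open>Dim Unit\<close> does not represent \<open>D\<^sub>I\<close>; it is merely a
  spare constant of type \<open>I\<close>.
\<close>

definition D :: "'a ty \<Rightarrow> ('a, 'c) trm" where
  "D A = (if A = Unit then One else Con (Dim A) False)"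

primrec vars :: "('a, 'c) trm \<Rightarrow> 'a var set" where
  "vars (Var x p) = {x}"
| "vars (Con k p) = {}"
| "vars One = {}"
| "vars (t \<otimes> u) = vars t \<union> vars u"

primrec const_free :: "('a, 'c) trm \<Rightarrow> bool" where
  "const_free (Var x p) = True"
| "const_free (Con k p) = False"
| "const_free One = False"
| "const_free (t \<otimes> u) = (const_free t \<and> const_free u)"

text \<open>
  Number of occurrences of \<open>u\<close> in a term; an occurrence of \<open>u\<^sub>*\<close> is an occurrence of \<open>u\<close>.
\<close>

primrec occ :: "('a, 'c) trm \<Rightarrow> ('a, 'c) trm \<Rightarrow> nat" where
  "occ u (Var x p) = (if Var x p = u \<or> Var x p = neg u then 1 else 0)"
| "occ u (Con k p) = (if Con k p = u \<or> Con k p = neg u then 1 else 0)"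
| "occ u One = (if One = u \<or> One = neg u then 1 else 0)"
| "occ u (a \<otimes> b) = (if a \<otimes> b = u \<or> a \<otimes> b = neg u then 1 else occ u a + occ u b)"

text \<open>Replacing \<open>u\<close> by \<open>t\<close>, and hence \<open>u\<^sub>*\<close> by \<open>t\<^sub>*\<close>.\<close>

primrec replace :: "('a, 'c) trm \<Rightarrow> ('a, 'c) trm \<Rightarrow> ('a, 'c) trm \<Rightarrow> ('a, 'c) trm" where
  "replace t u (Var x p) =
     (if Var x p = u then t else if Var x p = neg u then neg t else Var x p)"
| "replace t u (Con k p) =
     (if Con k p = u then t else if Con k p = neg u then neg t else Con k p)"
| "replace t u One = (if One = u then t else if One = neg u then neg t else One)"
| "replace t u (a \<otimes> b) =
     (if a \<otimes> b = u then t else if a \<otimes> b = neg u then neg t else replace t u a \<otimes> replace t u b)"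

text \<open>
  The substitution \<open>[t/u]\<close>.  It is ambiguous if \<open>u = u\<^sub>*\<close>, as for \<open>u = x \<otimes> x\<^sub>*\<close>, and is then defined
  to do nothing.  This case has no effect on the calculus: only captured terms are substituted
  for, and a captured term \<open>u = u\<^sub>*\<close> already contains both occurrences of each of its variables,
  so \<alpha>-renaming never applies to it and consumption finds no other copy of it.
\<close>

definition subst :: "('a, 'c) trm \<Rightarrow> ('a, 'c) trm \<Rightarrow> ('a, 'c) trm \<Rightarrow> ('a, 'c) trm" where
  "subst t u s = (if u = neg u then s else replace t u s)"

lemma dual_dual [simp]: "dual (dual A) = A"
  by (induction A) auto

lemma dual_inject [simp]: "dual A = dual B \<longleftrightarrow> A = B"
  by (metis dual_dual)

lemma neg_neg [simp]: "neg (neg t) = t"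
  by (induction t) auto

lemma neg_inject [simp]: "neg t = neg u \<longleftrightarrow> t = u"
  by (metis neg_neg)

lemma type_of_neg [simp]: "type_of (neg t) = dual (type_of t)"
  by (induction t) auto

lemma vars_neg [simp]: "vars (neg t) = vars t"
  by (induction t) auto

lemma type_of_D [simp]: "type_of (D A) = Unit"
  by (simp add: D_def)

lemma eq_neg_leaf:
  "Var x p = neg u \<longleftrightarrow> u = Var x (\<not> p)"
  "Con k p = neg u \<longleftrightarrow> u = Con k (\<not> p)"
  "One = neg u \<longleftrightarrow> u = One"
  by (cases u; auto)+

lemma occ_self: "s = u \<or> s = neg u \<Longrightarrow> occ u s = 1"
  by (cases s) auto

lemma occ_neg [simp]: "occ u (neg s) = occ u s"
proof (induction s)
  case (Tensor a b)
  show ?case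
  proof (cases "a \<otimes> b = u \<or> a \<otimes> b = neg u")
    case True
    then have "neg (a \<otimes> b) = u \<or> neg (a \<otimes> b) = neg u" by (metis neg_neg)
    with True show ?thesis by (simp only: occ_self)
  next
    case False
    then have "\<not> (neg (a \<otimes> b) = u \<or> neg (a \<otimes> b) = neg u)" by (metis neg_neg)
    with False show ?thesis by (simp add: Tensor.IH)
  qed
qed (auto simp: eq_neg_leaf)

lemma replace_self: "replace t u u = t"
  by (cases u) auto

lemma replace_self_neg: "u \<noteq> neg u \<Longrightarrow> replace t u (neg u) = neg t"
  by (cases "neg u") auto

lemma replace_neg:
  assumes "u \<noteq> neg u"
  shows "replace t u (neg s) = neg (replace t u s)"
proof (cases "s = u \<or> s = neg u")
  case True
  then show ?thesis using assms by (auto simp: replace_self replace_self_neg)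
next
  case False
  then show ?thesis
  proof (induction s)
    case (Tensor a b)
    have ab: "replace t u (neg r) = neg (replace t u r)" if "r = a \<or> r = b" for r
      using Tensor.IH that assms by (cases "r = u \<or> r = neg u") (auto simp: replace_self replace_self_neg)
    have "\<not> (neg (a \<otimes> b) = u \<or> neg (a \<otimes> b) = neg u)" using Tensor.prems by (metis neg_neg)
    then show ?case using Tensor.prems by (simp add: ab)
  qed (auto simp: eq_neg_leaf)
qed

lemma subst_neg: "subst t u (neg s) = neg (subst t u s)"
  by (simp add: subst_def replace_neg)

lemma type_of_replace:
  assumes "type_of t = type_of u"
  shows "type_of (replace t u s) = type_of s"
proof -
  have *: "type_of r = type_of s" if "s = u \<and> r = t \<or> s = neg u \<and> r = neg t" for r s
    using that assms by auto
  have "type_of (if s = u then t else if s = neg u then neg t else r) = type_of s"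
    if "type_of r = type_of s" for r s
    using *[of s t] *[of s "neg t"] that by simp
  then show ?thesis by (induction s) (simp_all only: replace.simps type_of.simps)
qed

lemma type_of_subst [simp]: "type_of t = type_of u \<Longrightarrow> type_of (subst t u s) = type_of s"
  by (simp add: subst_def type_of_replace)


section \<open>Soups\<close>

definition conn_eq :: "('a, 'c) trm \<times> ('a, 'c) trm \<Rightarrow> ('a, 'c) trm \<times> ('a, 'c) trm \<Rightarrow> bool" where
  "conn_eq p q \<longleftrightarrow> q = p \<or> q = (neg (snd p), neg (fst p))"

text \<open>
  Connections modulo \<open>t : u = u\<^sub>* : t\<^sub>*\<close>.  That both ends have the same type is imposed by
  \<open>conn_typed\<close> below.
\<close>

quotient_type ('a, 'c) conn = "('a, 'c) trm \<times> ('a, 'c) trm" / conn_eq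
  by (rule equivpI) (auto simp: reflp_def symp_def transp_def conn_eq_def)

lift_definition Conn :: "('a, 'c) trm \<Rightarrow> ('a, 'c) trm \<Rightarrow> ('a, 'c) conn"  (infix "\<bowtie>" 60)
  is Pair .

lift_definition conn_typed :: "('a, 'c) conn \<Rightarrow> bool"
  is "\<lambda>(t, u). type_of t = type_of u"
  by (auto simp: conn_eq_def)

lift_definition conn_neg :: "('a, 'c) conn \<Rightarrow> ('a, 'c) conn"
  is "\<lambda>(t, u). (neg t, neg u)"
  by (auto simp: conn_eq_def)

lift_definition conn_vars :: "('a, 'c) conn \<Rightarrow> 'a var set"
  is "\<lambda>(t, u). vars t \<union> vars u"
  by (auto simp: conn_eq_def)

lift_definition conn_occ :: "('a, 'c) trm \<Rightarrow> ('a, 'c) conn \<Rightarrow> nat"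
  is "\<lambda>s (t, u). occ s t + occ s u"
  by (auto simp: conn_eq_def)

lift_definition conn_subst ::
    "('a, 'c) trm \<Rightarrow> ('a, 'c) trm \<Rightarrow> ('a, 'c) conn \<Rightarrow> ('a, 'c) conn"
  is "\<lambda>t u (p, q). (subst t u p, subst t u q)"
  by (auto simp: conn_eq_def subst_neg)

lemma conn_flip: "t \<bowtie> u = neg u \<bowtie> neg t"
  by transfer (simp add: conn_eq_def)

lemma conn_neg_flip: "conn_neg (t \<bowtie> u) = u \<bowtie> t"
  by transfer (simp add: conn_eq_def)

lemma conn_typed_Conn [simp]: "conn_typed (t \<bowtie> u) \<longleftrightarrow> type_of t = type_of u"
  by transfer simp

lemma conn_typed_neg [simp]: "conn_typed (conn_neg k) \<longleftrightarrow> conn_typed k"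
  by transfer auto

lemma conn_typed_subst [simp]:
  "type_of t = type_of u \<Longrightarrow> conn_typed (conn_subst t u k) \<longleftrightarrow> conn_typed k"
  by transfer auto

type_synonym ('a, 'c) soup = "('a, 'c) conn fset"


section \<open>Typing judgements\<close>

text \<open>
  The sequent \<open>t\<^sub>1 : A\<^sub>1, \<dots>, t\<^sub>n : A\<^sub>n \<turnstile>\<^sub>S t : B\<close>.  The ascriptions are not stored, every term having exactly
  one type \<open>type_of t\<close>.
\<close>

datatype ('a, 'c) judgement =
  Judgement "('a, 'c) trm list" "('a, 'c) soup" "('a, 'c) trm"  ("(_ \<turnstile>\<^bsub>_\<^esub> _)" [51, 0, 51] 50)

primrec typing_judgement :: "('a, 'c) judgement \<Rightarrow> bool" where
  "typing_judgement (\<Gamma> \<turnstile>\<^bsub>S\<^esub> b) = (\<forall>k \<in> fset S. conn_typed k)"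

primrec jvars :: "('a, 'c) judgement \<Rightarrow> 'a var set" where
  "jvars (\<Gamma> \<turnstile>\<^bsub>S\<^esub> b) = (\<Union>t \<in> set \<Gamma>. vars t) \<union> (\<Union>k \<in> fset S. conn_vars k) \<union> vars b"

primrec jocc :: "('a, 'c) trm \<Rightarrow> ('a, 'c) judgement \<Rightarrow> nat" where
  "jocc u (\<Gamma> \<turnstile>\<^bsub>S\<^esub> b) = (\<Sum>t \<leftarrow> \<Gamma>. occ u t) + (\<Sum>k \<in> fset S. conn_occ u k) + occ u b"

primrec jsubst ::
    "('a, 'c) trm \<Rightarrow> ('a, 'c) trm \<Rightarrow> ('a, 'c) judgement \<Rightarrow> ('a, 'c) judgement" where
  "jsubst t u (\<Gamma> \<turnstile>\<^bsub>S\<^esub> b) = (map (subst t u) \<Gamma> \<turnstile>\<^bsub>conn_subst t u |`| S\<^esub> subst t u b)"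

definition bound :: "'a var \<Rightarrow> ('a, 'c) judgement \<Rightarrow> bool" where
  "bound x J \<longleftrightarrow> jocc (V x) J = 2"

definition captured :: "('a, 'c) trm \<Rightarrow> ('a, 'c) judgement \<Rightarrow> bool" where
  "captured u J \<longleftrightarrow> const_free u \<and> (\<forall>x \<in> vars u. bound x J)"


section \<open>\<alpha>-equivalence\<close>

definition linear_term :: "('a, 'c) trm \<Rightarrow> bool" where
  "linear_term t \<longleftrightarrow> (\<forall>y \<in> vars t. occ (V y) t = 1)"

text \<open>
  The fresh variables of the term replacing a bound variable are pairwise distinct, so that each
  of them again occurs exactly twice in the renamed judgement.
\<close>

inductive alpha_rename :: "('a, 'c) judgement \<Rightarrow> ('a, 'c) judgement \<Rightarrow> bool" where
  var_to_term:
    "\<lbrakk>bound x J; const_free t; linear_term t; type_of t = var_type x; vars t \<inter> jvars J = {}\<rbrakk>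
     \<Longrightarrow> alpha_rename J (jsubst t (V x) J)"
| term_to_var:
    "\<lbrakk>captured u J; jocc u J = 2; var_type x = type_of u; x \<notin> jvars J\<rbrakk>
     \<Longrightarrow> alpha_rename J (jsubst (V x) u J)"

definition alpha_eq :: "('a, 'c) judgement \<Rightarrow> ('a, 'c) judgement \<Rightarrow> bool"  (infix "\<approx>\<^sub>\<alpha>" 50) where
  "alpha_eq = equivclp alpha_rename"


section \<open>Derivable judgements\<close>

text \<open>\<open>\<Otimes>\<Delta>\<close> as a context of one term; for empty \<open>\<Delta>\<close> nothing is added to the context.\<close>

fun ctx_tensor :: "('a, 'c) trm list \<Rightarrow> ('a, 'c) trm list" where
  "ctx_tensor [] = []"
| "ctx_tensor (t # ts) = [foldl Tensor t ts]"

text \<open>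
  In the inverse unit rules \<open>S \<union> {i\<^sub>* : 1}\<close> is a disjoint union.  The last rule says that derivability
  is a property of judgements up to \<alpha>-equivalence.
\<close>

inductive derivable :: "('a, 'c) judgement \<Rightarrow> bool" where
  Id: "derivable ([V x] \<turnstile>\<^bsub>{||}\<^esub> V x)"
| Negation: "derivable ([a] \<turnstile>\<^bsub>S\<^esub> b) \<Longrightarrow> derivable ([neg a] \<turnstile>\<^bsub>conn_neg |`| S\<^esub> neg b)"
| Cut: "\<lbrakk>derivable (\<Gamma> \<turnstile>\<^bsub>S1\<^esub> a); derivable (a' # \<Delta> \<turnstile>\<^bsub>S2\<^esub> b); type_of a = type_of a';
      jvars (\<Gamma> \<turnstile>\<^bsub>S1\<^esub> a) \<inter> jvars (a' # \<Delta> \<turnstile>\<^bsub>S2\<^esub> b) = {}\<rbrakk>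
    \<Longrightarrow> derivable (\<Gamma> @ \<Delta> \<turnstile>\<^bsub>S1 |\<union>| S2 |\<union>| {|a \<bowtie> a'|}\<^esub> b)"
| TensorR: "\<lbrakk>derivable (\<Gamma> \<turnstile>\<^bsub>S1\<^esub> a); derivable (\<Delta> \<turnstile>\<^bsub>S2\<^esub> b);
      jvars (\<Gamma> \<turnstile>\<^bsub>S1\<^esub> a) \<inter> jvars (\<Delta> \<turnstile>\<^bsub>S2\<^esub> b) = {}\<rbrakk>
    \<Longrightarrow> derivable (\<Gamma> @ ctx_tensor \<Delta> \<turnstile>\<^bsub>S1 |\<union>| S2\<^esub> a \<otimes> b)"
| Curry: "derivable (a # \<Gamma> \<turnstile>\<^bsub>S\<^esub> b) \<Longrightarrow> derivable (\<Gamma> \<turnstile>\<^bsub>S\<^esub> neg a \<otimes> b)"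
| Uncurry: "derivable (\<Gamma> \<turnstile>\<^bsub>S\<^esub> neg a \<otimes> b) \<Longrightarrow> derivable (a # \<Gamma> \<turnstile>\<^bsub>S\<^esub> b)"
| TensorL: "derivable (\<Gamma> @ [a, b] \<turnstile>\<^bsub>S\<^esub> c) \<Longrightarrow> derivable (\<Gamma> @ [a \<otimes> b] \<turnstile>\<^bsub>S\<^esub> c)"
| TensorL_inv: "derivable (\<Gamma> @ [a \<otimes> b] \<turnstile>\<^bsub>S\<^esub> c) \<Longrightarrow> derivable (\<Gamma> @ [a, b] \<turnstile>\<^bsub>S\<^esub> c)"
| Exchange: "derivable (\<Gamma> @ [a, b] @ \<Delta> \<turnstile>\<^bsub>S\<^esub> c) \<Longrightarrow> derivable (\<Gamma> @ [b, a] @ \<Delta> \<turnstile>\<^bsub>S\<^esub> c)"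
| UnitL: "\<lbrakk>derivable (i # \<Gamma> \<turnstile>\<^bsub>S\<^esub> b); type_of i = Unit\<rbrakk>
    \<Longrightarrow> derivable (\<Gamma> \<turnstile>\<^bsub>finsert (neg i \<bowtie> One) S\<^esub> b)"
| UnitL_inv: "\<lbrakk>derivable (\<Gamma> \<turnstile>\<^bsub>finsert (neg i \<bowtie> One) S\<^esub> b); (neg i \<bowtie> One) |\<notin>| S; type_of i = Unit\<rbrakk>
    \<Longrightarrow> derivable (i # \<Gamma> \<turnstile>\<^bsub>S\<^esub> b)"
| UnitR: "\<lbrakk>derivable (\<Gamma> @ [i] \<turnstile>\<^bsub>S\<^esub> b); type_of i = Unit\<rbrakk>
    \<Longrightarrow> derivable (\<Gamma> \<turnstile>\<^bsub>finsert (neg i \<bowtie> One) S\<^esub> b)"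
| UnitR_inv: "\<lbrakk>derivable (\<Gamma> \<turnstile>\<^bsub>finsert (neg i \<bowtie> One) S\<^esub> b); (neg i \<bowtie> One) |\<notin>| S; type_of i = Unit\<rbrakk>
    \<Longrightarrow> derivable (\<Gamma> @ [i] \<turnstile>\<^bsub>S\<^esub> b)"
| OneI: "derivable ([] \<turnstile>\<^bsub>{||}\<^esub> One)"
| Constant: "\<lbrakk>const_type f = dual (var_type x) \<otimes>\<^sub>T var_type y; x \<noteq> y\<rbrakk>
    \<Longrightarrow> derivable ([V x] \<turnstile>\<^bsub>{|Con f False \<bowtie> neg (V x) \<otimes> V y|}\<^esub> V y)"
| Alpha: "\<lbrakk>derivable J; J \<approx>\<^sub>\<alpha> J'\<rbrakk> \<Longrightarrow> derivable J'"

lemma typing_judgement_jsubst: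
  "type_of t = type_of u \<Longrightarrow> typing_judgement (jsubst t u J) \<longleftrightarrow> typing_judgement J"
  by (cases J) auto

lemma alpha_rename_typing: "alpha_rename J J' \<Longrightarrow> typing_judgement J' \<longleftrightarrow> typing_judgement J"
  by (induction rule: alpha_rename.induct) (simp_all add: typing_judgement_jsubst)

lemma alpha_eq_typing: "J \<approx>\<^sub>\<alpha> J' \<Longrightarrow> typing_judgement J' \<longleftrightarrow> typing_judgement J"
  unfolding alpha_eq_def
  by (induction rule: equivclp_induct) (auto dest: alpha_rename_typing)

lemma derivable_typing: "derivable J \<Longrightarrow> typing_judgement J"
  by (induction rule: derivable.induct) (auto simp: alpha_eq_typing)


section \<open>Soup reduction\<close>

text \<open>
  As soups are sets, \<open>S \<union> {k}\<close> on the left of a rule has to be read as a disjoint union: the rule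
  removes the connection \<open>k\<close> from the soup.
\<close>

inductive bifunctoriality :: "('a, 'c) judgement \<Rightarrow> ('a, 'c) judgement \<Rightarrow> bool" where
  "(a \<otimes> b \<bowtie> c \<otimes> d) |\<notin>| S \<Longrightarrow>
   bifunctoriality (\<Gamma> \<turnstile>\<^bsub>finsert (a \<otimes> b \<bowtie> c \<otimes> d) S\<^esub> e) (\<Gamma> \<turnstile>\<^bsub>finsert (a \<bowtie> c) (finsert (b \<bowtie> d) S)\<^esub> e)"

inductive trace_rule :: "('a, 'c) judgement \<Rightarrow> ('a, 'c) judgement \<Rightarrow> bool" where
  "(V x \<bowtie> V x) |\<notin>| S \<Longrightarrow>
   trace_rule (\<Gamma> \<turnstile>\<^bsub>finsert (V x \<bowtie> V x) S\<^esub> e) (\<Gamma> \<turnstile>\<^bsub>finsert (D (var_type x) \<bowtie> One) S\<^esub> e)"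

inductive cancellation :: "('a, 'c) judgement \<Rightarrow> ('a, 'c) judgement \<Rightarrow> bool" where
  "(One \<bowtie> One) |\<notin>| S \<Longrightarrow> cancellation (\<Gamma> \<turnstile>\<^bsub>finsert (One \<bowtie> One) S\<^esub> e) (\<Gamma> \<turnstile>\<^bsub>S\<^esub> e)"

inductive consumption :: "('a, 'c) judgement \<Rightarrow> ('a, 'c) judgement \<Rightarrow> bool" where
  "\<lbrakk>(t \<bowtie> u) |\<notin>| S; captured u (\<Gamma> \<turnstile>\<^bsub>finsert (t \<bowtie> u) S\<^esub> e)\<rbrakk> \<Longrightarrow>
   consumption (\<Gamma> \<turnstile>\<^bsub>finsert (t \<bowtie> u) S\<^esub> e) (jsubst t u (\<Gamma> \<turnstile>\<^bsub>S\<^esub> e))"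
| "\<lbrakk>(t \<bowtie> u) |\<notin>| S; captured t (\<Gamma> \<turnstile>\<^bsub>finsert (t \<bowtie> u) S\<^esub> e)\<rbrakk> \<Longrightarrow>
   consumption (\<Gamma> \<turnstile>\<^bsub>finsert (t \<bowtie> u) S\<^esub> e) (jsubst u t (\<Gamma> \<turnstile>\<^bsub>S\<^esub> e))"

definition soup_rule :: "('a, 'c) judgement \<Rightarrow> ('a, 'c) judgement \<Rightarrow> bool" where
  "soup_rule J K \<longleftrightarrow> bifunctoriality J K \<or> trace_rule J K \<or> cancellation J K \<or> consumption J K"

text \<open>One soup reduction step between \<alpha>-equivalence classes of judgements.\<close>

definition soup_step :: "('a, 'c) judgement \<Rightarrow> ('a, 'c) judgement \<Rightarrow> bool"  (infix "\<leadsto>" 50) where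
  "J \<leadsto> K \<longleftrightarrow> (\<exists>J' K'. J \<approx>\<^sub>\<alpha> J' \<and> soup_rule J' K' \<and> K' \<approx>\<^sub>\<alpha> K)"

text \<open>No rule applies to any judgement in the \<alpha>-equivalence class.\<close>

definition normal_form :: "('a, 'c) judgement \<Rightarrow> bool" where
  "normal_form J \<longleftrightarrow> (\<forall>J' K. J \<approx>\<^sub>\<alpha> J' \<longrightarrow>
     \<not> bifunctoriality J' K \<and> \<not> trace_rule J' K \<and> \<not> cancellation J' K \<and> \<not> consumption J' K)"

end

theory Submission
  imports Defs
begin

text \<open>
  Give every connection a weight that depends only on the types of its two ends, and hence is
  unchanged by typed substitutions, except that \<open>1 : 1\<close> weighs less than any other connection.  The
  total weight of the soup is invariant under \<alpha>-renaming, because renaming by fresh variables is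
  injective on the soup, and every soup rule decreases it.
\<close>

primrec ty_weight :: "'a ty \<Rightarrow> nat" where
  "ty_weight Unit = 2"
| "ty_weight (Atom X p) = 3"
| "ty_weight (A \<otimes>\<^sub>T B) = ty_weight A + ty_weight B + 1"

lemma ty_weight_dual [simp]: "ty_weight (dual A) = ty_weight A"
  by (induction A) auto

lemma ty_weight_ge: "2 \<le> ty_weight A"
  by (induction A) auto

text \<open>The trace rule at a type other than I puts two ends of type I in place of two ends of
  type \<open>A\<close>, so the latter have to be heavier.\<close>

lemma ty_weight_gt: "A \<noteq> Unit \<Longrightarrow> 2 < ty_weight A"
proof (cases A)
  case (TTensor B C)
  then show ?thesis using ty_weight_ge[of B] by simp
qed auto

lemma neg_eq_One_iff [simp]: "neg t = One \<longleftrightarrow> t = One"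
  by (cases t) auto

text \<open>
  The exception for \<open>1 : 1\<close> makes the trace rule decrease the weight at type \<open>I\<close>, where \<open>D\<^sub>I = 1\<close>.
  Both ends are counted so that the weight respects \<open>t : u = u\<^sub>* : t\<^sub>*\<close> for untyped connections as well.
\<close>

lift_definition conn_weight :: "('a, 'c) conn \<Rightarrow> nat"
  is "\<lambda>(t, u). if t = One \<and> u = One then 1 else ty_weight (type_of t) + ty_weight (type_of u)"
  by (auto simp: conn_eq_def)

lemma conn_weight_Conn:
  "conn_weight (t \<bowtie> u) =
     (if t = One \<and> u = One then 1 else ty_weight (type_of t) + ty_weight (type_of u))"
  by transfer simp

lemma conn_weight_le: "conn_weight (t \<bowtie> u) \<le> ty_weight (type_of t) + ty_weight (type_of u)"
  by (simp add: conn_weight_Conn)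

lemma conn_weight_pos: "0 < conn_weight k"
proof (transfer, clarify)
  fix t u :: "('a, 'b) trm"
  show "0 < (if t = One \<and> u = One then 1 else ty_weight (type_of t) + ty_weight (type_of u))"
    using ty_weight_ge[of "type_of t"] by simp
qed

definition soup_weight :: "('a, 'c) soup \<Rightarrow> nat" where
  "soup_weight S = (\<Sum>k \<in> fset S. conn_weight k)"

primrec jweight :: "('a, 'c) judgement \<Rightarrow> nat" where
  "jweight (\<Gamma> \<turnstile>\<^bsub>S\<^esub> b) = soup_weight S"

lemma soup_weight_finsert: "k |\<notin>| S \<Longrightarrow> soup_weight (finsert k S) = conn_weight k + soup_weight S"
  by (simp add: soup_weight_def)

text \<open>Soups are sets, so a connection produced by a rule may already be present and then adds
  nothing.\<close>

lemma soup_weight_finsert_le: "soup_weight (finsert k S) \<le> conn_weight k + soup_weight S"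
  by (simp add: soup_weight_def sum.insert_if)


section \<open>Invariance under \<alpha>-equivalence\<close>

lemma size_neg [simp]: "size (neg t) = size t"
  by (induction t) auto

lemma const_free_neg [simp]: "const_free (neg t) = const_free t"
  by (induction t) auto

lemma const_free_vars: "const_free t \<Longrightarrow> vars t \<noteq> {}"
  by (induction t) auto

lemma occ_var_pos: "y \<in> vars t \<Longrightarrow> 0 < occ (V y) t"
  by (induction t) auto

text \<open>A tensor \<open>a \<otimes> b\<close> equal to its own negation has
  \<open>a = neg b\<close>. Both factors then have the same variables, and each of these occurs at
  least twice.\<close>

lemma linear_term_neq_neg:
  assumes "const_free t" and "linear_term t"
  shows "t \<noteq> neg t"
proof (cases t)
  case (Tensor a b)
  show ?thesis
  proof
    assume "t = neg t"
    then have "vars a = vars b" using Tensor by (metis neg.simps(4) trm.inject(3) vars_neg)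
    moreover obtain y where "y \<in> vars a" using assms Tensor const_free_vars by fastforce
    moreover have "occ (V y) t = occ (V y) a + occ (V y) b" using Tensor by simp
    ultimately have "2 \<le> occ (V y) t" and "y \<in> vars t"
      using occ_var_pos[of y a] occ_var_pos[of y b] Tensor by auto
    then show False using assms(2) by (auto simp: linear_term_def)
  qed
qed (use assms in auto)

text \<open>A constant-free term contains a variable, so a copy of \<open>t\<close> or
  \<open>neg t\<close> inside \<open>s\<close> would give \<open>s\<close> a variable of
  \<open>t\<close>.\<close>

lemma replace_absent:
  assumes "const_free t" and "vars t \<inter> vars s = {}"
  shows "replace u t s = s"
proof -
  have *: "r \<noteq> t \<and> r \<noteq> neg t" if "vars t \<inter> vars r = {}" for r
    using that const_free_vars[OF assms(1)] by auto
  show ?thesis using assms(2)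
  proof (induction s)
    case (Tensor a b)
    then show ?case using *[of "a \<otimes> b"] by (simp add: Int_Un_distrib)
  qed (use * in force)+
qed

text \<open>A term that is changed contains a copy of \<open>t\<close> or \<open>neg t\<close>
  afterwards, and these have the same size.\<close>

lemma replace_id_or_size: "replace t u s = s \<or> size t \<le> size (replace t u s)"
  by (induction s) auto

text \<open>
  Substituting \<open>t\<close> properly inside a term yields a term larger than \<open>t\<close>, so it creates no further
  copy of \<open>t\<close> for the second substitution to act on.
\<close>

lemma replace_replace_fresh:
  assumes "const_free t" and "t \<noteq> neg t" and "u \<noteq> neg u" and "vars t \<inter> vars s = {}"
  shows "replace u t (replace t u s) = s"
  using assms(4)
proof (induction s)
  case (Tensor a b)
  consider "a \<otimes> b = u \<or> a \<otimes> b = neg u" | "a \<otimes> b \<noteq> u" "a \<otimes> b \<noteq> neg u" by blast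
  then show ?case
  proof cases
    case 1
    then show ?thesis using assms(2,3) by (metis replace_self replace_self_neg)
  next
    case 2
    let ?r = "replace t u a \<otimes> replace t u b"
    \<comment> \<open>Here \<open>w\<close> stands for \<open>t\<close> and \<open>neg t\<close> at
      once. If \<open>?r\<close> were \<open>w\<close>, both its factors would be smaller than
      \<open>t\<close>, hence unchanged, so \<open>a \<otimes> b\<close> itself would contain the
      variables of \<open>t\<close>.\<close>
    have "?r \<noteq> w" if w: "vars w = vars t" "size w = size t" for w
    proof
      assume r: "?r = w"
      then have "size (replace t u a) < size t" "size (replace t u b) < size t"
        using w by auto
      then have "?r = a \<otimes> b" using replace_id_or_size[of t u a] replace_id_or_size[of t u b] by auto
      then show False using r w Tensor.prems const_free_vars[OF assms(1)] by auto
    qed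
    from this[of t] this[of "neg t"] have "?r \<noteq> t" "?r \<noteq> neg t" by simp_all
    then show ?thesis using 2 Tensor by (simp add: Int_Un_distrib)
  qed
next
  case (Var x p)
  have "Var x p \<noteq> t" "Var x p \<noteq> neg t" using Var by (auto simp: eq_neg_leaf)
  then show ?case using assms(2,3) by (auto simp: replace_self replace_self_neg)
next
  case (Con k p)
  have "Con k p \<noteq> t" "Con k p \<noteq> neg t" using assms(1) by (auto simp: eq_neg_leaf)
  then show ?case using assms(2,3) by (auto simp: replace_self replace_self_neg)
next
  case One
  have "One \<noteq> t" "One \<noteq> neg t" using assms(1) by (auto simp: eq_neg_leaf)
  then show ?case using assms(2,3) by (auto simp: replace_self replace_self_neg)
qed

text \<open>If \<open>u = neg u\<close>, the inner substitution does nothing by definition, and the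
  outer one finds no copy of \<open>t\<close> in \<open>s\<close>.\<close>

lemma subst_subst_fresh:
  assumes "const_free t" and "t \<noteq> neg t" and "vars t \<inter> vars s = {}"
  shows "subst u t (subst t u s) = s"
  using assms replace_replace_fresh[of t u s] replace_absent[of t s u] by (simp add: subst_def)

lemma conn_subst_subst_fresh:
  assumes "const_free t" and "t \<noteq> neg t" and "vars t \<inter> conn_vars k = {}"
  shows "conn_subst u t (conn_subst t u k) = k"
  using assms
proof (transfer fixing: t u)
  fix k :: "('a, 'b) trm \<times> ('a, 'b) trm"
  assume "const_free t" "t \<noteq> neg t" "vars t \<inter> (case k of (p, q) \<Rightarrow> vars p \<union> vars q) = {}"
  then show "conn_eq (case case k of (p, q) \<Rightarrow> (subst t u p, subst t u q) of
      (p, q) \<Rightarrow> (subst u t p, subst u t q)) k"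
    by (auto simp: conn_eq_def subst_subst_fresh Int_Un_distrib split: prod.splits)
qed

section \<open>Connection weights under substitution\<close>

lemma subst_One [simp]: "const_free u \<Longrightarrow> subst t u One = One"
  by (auto simp: subst_def eq_neg_leaf)

lemma subst_eq_One_iff: "const_free t \<Longrightarrow> const_free u \<Longrightarrow> subst t u s = One \<longleftrightarrow> s = One"
  by (cases s) (auto simp: subst_def eq_neg_leaf)

text \<open>Consumption may substitute a term \<open>t\<close> with constants. This can create the
  light connection \<open>1 : 1\<close> but never destroys one, as \<open>u\<close> has no
  constants.\<close>

lemma conn_weight_subst_le:
  assumes "const_free u" and "type_of t = type_of u"
  shows "conn_weight (conn_subst t u k) \<le> conn_weight k"
proof -
  have "Suc 0 \<le> ty_weight A + m" for A :: "'a ty" and m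
    using ty_weight_ge[of A] by simp
  then show ?thesis using assms by (transfer fixing: t u) (auto split: if_splits)
qed

lemma conn_weight_subst:
  assumes "const_free t" and "const_free u" and "type_of t = type_of u"
  shows "conn_weight (conn_subst t u k) = conn_weight k"
  using assms by (transfer fixing: t u) (auto simp: subst_eq_One_iff split: if_splits)

text \<open>Substituting back is a left inverse on the soup, so no two connections merge. As neither
  term contains constants, each connection also keeps its weight.\<close>

lemma jweight_jsubst_fresh:
  assumes "const_free t" and "t \<noteq> neg t" and "const_free u" and "type_of t = type_of u"
    and "vars t \<inter> jvars J = {}"
  shows "jweight (jsubst t u J) = jweight J"
proof (cases J)
  case (Judgement \<Gamma> S b)
  have "inj_on (conn_subst t u) (fset S)"
  proof (rule inj_on_inverseI)
    fix k assume "k \<in> fset S"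
    then have "vars t \<inter> conn_vars k = {}" using assms(5) Judgement by auto
    then show "conn_subst u t (conn_subst t u k) = k" by (rule conn_subst_subst_fresh[OF assms(1,2)])
  qed
  then show ?thesis
    using Judgement assms(1,3,4) by (simp add: soup_weight_def sum.reindex conn_weight_subst)
qed

lemma alpha_rename_jweight: "alpha_rename J J' \<Longrightarrow> jweight J' = jweight J"
proof (induction rule: alpha_rename.induct)
  case (var_to_term x J t)
  then show ?case by (intro jweight_jsubst_fresh) (simp_all add: linear_term_neq_neg)
next
  case (term_to_var u J x)
  then show ?case by (intro jweight_jsubst_fresh) (simp_all add: captured_def)
qed

lemma alpha_eq_jweight: "J \<approx>\<^sub>\<alpha> J' \<Longrightarrow> jweight J' = jweight J"
  unfolding alpha_eq_def
  by (induction rule: equivclp_induct) (auto dest: alpha_rename_jweight)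


section \<open>Soup rules\<close>

text \<open>No freshness is available for consumption, so connections may merge; this only removes
  summands.\<close>

lemma soup_weight_subst_le:
  assumes "const_free u" and "type_of t = type_of u"
  shows "soup_weight (conn_subst t u |`| S) \<le> soup_weight S"
proof -
  have "soup_weight (conn_subst t u |`| S) \<le> (\<Sum>k \<in> fset S. conn_weight (conn_subst t u k))"
    using sum_image_le[of "fset S" conn_weight "conn_subst t u"] by (simp add: soup_weight_def o_def)
  also have "\<dots> \<le> soup_weight S"
    unfolding soup_weight_def by (intro sum_mono conn_weight_subst_le assms)
  finally show ?thesis .
qed

text \<open>Splitting the two tensors gives up the extra 1 that \<open>ty_weight\<close> counts for
  each. Upper bounds suffice for the new connections, which may be \<open>1 : 1\<close> or already
  in the soup.\<close>

lemma bifunctoriality_jweight: "bifunctoriality J K \<Longrightarrow> jweight K < jweight J"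
proof (induction rule: bifunctoriality.induct)
  case (1 a b c d S \<Gamma> e)
  then show ?case
    using soup_weight_finsert[OF 1] conn_weight_le[of a c] conn_weight_le[of b d]
      soup_weight_finsert_le[of "a \<bowtie> c" "finsert (b \<bowtie> d) S"] soup_weight_finsert_le[of "b \<bowtie> d" S]
    by (simp add: conn_weight_Conn)
qed

lemma trace_rule_jweight: "trace_rule J K \<Longrightarrow> jweight K < jweight J"
proof (induction rule: trace_rule.induct)
  case (1 x S \<Gamma> e)
  \<comment> \<open>At type I the new connection is \<open>1 : 1\<close>, of weight 1 against 4. At
    any other type its weight is 4, and \<open>ty_weight_gt\<close> applies to both ends of the old
    one.\<close>
  have "conn_weight (D (var_type x) \<bowtie> (One :: ('a, 'b) trm)) < conn_weight (V x \<bowtie> (V x :: ('a, 'b) trm))"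
    using ty_weight_gt[of "var_type x"] by (auto simp: conn_weight_Conn D_def)
  then show ?case
    using soup_weight_finsert[OF 1] soup_weight_finsert_le[of "D (var_type x) \<bowtie> One" S] by simp
qed

lemma cancellation_jweight: "cancellation J K \<Longrightarrow> jweight K < jweight J"
  by (induction rule: cancellation.induct) (simp add: soup_weight_finsert conn_weight_pos)

text \<open>The consumed connection has positive weight. Typing gives its ends the same type, so the
  substitution does not make the rest of the soup heavier.\<close>

lemma consumption_jweight: "consumption J K \<Longrightarrow> typing_judgement J \<Longrightarrow> jweight K < jweight J"
proof (induction rule: consumption.induct)
  case (1 t u S \<Gamma> e)
  then show ?case
    using soup_weight_finsert[OF 1(1)] conn_weight_pos[of "t \<bowtie> u"] soup_weight_subst_le[of u t S]
    by (simp add: captured_def)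
next
  case (2 t u S \<Gamma> e)
  then show ?case
    using soup_weight_finsert[OF 2(1)] conn_weight_pos[of "t \<bowtie> u"] soup_weight_subst_le[of t u S]
    by (simp add: captured_def)
qed

lemma soup_rule_jweight: "soup_rule J K \<Longrightarrow> typing_judgement J \<Longrightarrow> jweight K < jweight J"
  unfolding soup_rule_def
  using bifunctoriality_jweight trace_rule_jweight cancellation_jweight consumption_jweight by blast

lemma soup_rule_typing: "soup_rule J K \<Longrightarrow> typing_judgement J \<Longrightarrow> typing_judgement K"
  unfolding soup_rule_def
  by (auto elim!: bifunctoriality.cases trace_rule.cases cancellation.cases consumption.cases
      simp del: jsubst.simps simp: typing_judgement_jsubst)

section \<open>Soup steps modulo \<alpha>-equivalence and normal forms\<close>

lemma soup_step_typing: "J \<leadsto> K \<Longrightarrow> typing_judgement J \<Longrightarrow> typing_judgement K"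
  unfolding soup_step_def using alpha_eq_typing soup_rule_typing by blast

lemma soup_step_jweight: "J \<leadsto> K \<Longrightarrow> typing_judgement J \<Longrightarrow> jweight K < jweight J"
  unfolding soup_step_def using alpha_eq_typing alpha_eq_jweight soup_rule_jweight by metis

lemma soup_steps_typing: "soup_step\<^sup>*\<^sup>* J K \<Longrightarrow> typing_judgement J \<Longrightarrow> typing_judgement K"
  by (induction rule: rtranclp_induct) (auto intro: soup_step_typing)

lemma alpha_eq_refl: "J \<approx>\<^sub>\<alpha> J"
  by (simp add: alpha_eq_def)

lemma irreducible_normal_form: "\<nexists>K. J \<leadsto> K \<Longrightarrow> normal_form J"
  unfolding normal_form_def soup_step_def soup_rule_def using alpha_eq_refl by blast

text \<open>Any available step will do, since each one lowers \<open>jweight\<close>.\<close>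

lemma normal_form_reachable:
  "typing_judgement J \<Longrightarrow> \<exists>N. soup_step\<^sup>*\<^sup>* J N \<and> typing_judgement N \<and> normal_form N"
proof (induction J rule: measure_induct_rule[of jweight])
  case (less J)
  show ?case
  proof (cases "\<exists>K. J \<leadsto> K")
    case True
    then obtain K where "J \<leadsto> K" by blast
    then show ?thesis
      using less soup_step_jweight soup_step_typing converse_rtranclp_into_rtranclp[of soup_step]
      by metis
  next
    case False
    then show ?thesis using less.prems irreducible_normal_form by blast
  qed
qed

theorem theorem2p4:
  fixes J :: "('a, 'c) judgement"
  assumes "typing_judgement J"
  shows "(\<nexists>\<sigma> :: nat \<Rightarrow> ('a, 'c) judgement. \<sigma> 0 \<approx>\<^sub>\<alpha> J \<and> (\<forall>i. \<sigma> i \<leadsto> \<sigma> (Suc i)))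
    \<and> (\<forall>K. soup_step\<^sup>*\<^sup>* J K \<and> (\<nexists>K'. K \<leadsto> K') \<longrightarrow> typing_judgement K \<and> normal_form K)
    \<and> (\<forall>K. soup_step\<^sup>*\<^sup>* J K \<longrightarrow> (\<exists>N. soup_step\<^sup>*\<^sup>* K N \<and> typing_judgement N \<and> normal_form N))"
proof (intro conjI)
  show "\<nexists>\<sigma> :: nat \<Rightarrow> ('a, 'c) judgement. \<sigma> 0 \<approx>\<^sub>\<alpha> J \<and> (\<forall>i. \<sigma> i \<leadsto> \<sigma> (Suc i))"
  proof
    assume "\<exists>\<sigma> :: nat \<Rightarrow> ('a, 'c) judgement. \<sigma> 0 \<approx>\<^sub>\<alpha> J \<and> (\<forall>i. \<sigma> i \<leadsto> \<sigma> (Suc i))"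
    then obtain \<sigma> :: "nat \<Rightarrow> ('a, 'c) judgement"
      where \<sigma>: "\<sigma> 0 \<approx>\<^sub>\<alpha> J" "\<And>i. \<sigma> i \<leadsto> \<sigma> (Suc i)" by blast
    \<comment> \<open>The weight is known to decrease only from typing judgements, so typing is
      first carried along the whole sequence.\<close>
    have "typing_judgement (\<sigma> i)" for i
      by (induction i) (use \<sigma> assms alpha_eq_typing soup_step_typing in blast)+
    then have "jweight (\<sigma> (Suc i)) < jweight (\<sigma> i)" for i
      using \<sigma>(2) soup_step_jweight by blast
    then show False
      using wf_less_than wf_no_infinite_down_chainE[of less_than "\<lambda>i. jweight (\<sigma> i)"] by auto
  qed
next
  show "\<forall>K. soup_step\<^sup>*\<^sup>* J K \<and> (\<nexists>K'. K \<leadsto> K') \<longrightarrow> typing_judgement K \<and> normal_form K"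
    using assms soup_steps_typing irreducible_normal_form by blast
next
  show "\<forall>K. soup_step\<^sup>*\<^sup>* J K \<longrightarrow> (\<exists>N. soup_step\<^sup>*\<^sup>* K N \<and> typing_judgement N \<and> normal_form N)"
    using assms soup_steps_typing normal_form_reachable by blast
qed

end
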